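(* $$\int_0^1\frac{4\,\mathrm{Li}_3\left(-\frac{x}{1+x^2}\right)}{x}\,dx=-\frac{403\pi^4}{12960}.$$
   Context: For $k\in\mathbb{N}$ (positive integers) and $|z|\le 1$, the polylogarithm is $\mathrm{Li}_k(z)=\sum_{n=1}^{\infty}\frac{z^n}{n^k}$. *)

theory Defs
  imports "HOL-Analysis.Analysis"
begin

text \<open>The polylogarithm by its power series, meant for \<open>k \<ge> 1\<close> and \<open>norm z \<le> 1\<close>
  (excluding \<open>k = 1, z = 1\<close>, where the series diverges). The index is shifted: the summand
  for \<open>n\<close> is the term of exponent \<open>n + 1\<close>.\<close>

definition polylog :: "nat \<Rightarrow> 'a \<Rightarrow> 'a::{real_normed_field, banach}" where
  "polylog k z = (\<Sum>n. z ^ Suc n / of_nat (Suc n) ^ k)"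

end

theory Submission
  imports Defs "HOL-Complex_Analysis.Cauchy_Integral_Theorem" "HOL-Real_Asymp.Real_Asymp"
begin

text \<open>
  Put \<open>u = x / (1 + x\<^sup>2)\<close>. The power series gives
  \<open>Li\<^sub>3(-u) = -1/2 \<integral> (ln a)\<^sup>2 u / (1 + a u) da\<close> over \<open>a \<in> [0, 1]\<close>, and
  \<open>u / (x (1 + a u)) = 1 / (1 + a x + x\<^sup>2)\<close>. With \<open>a = 2 cos t\<close> the integral to be computed is
  therefore \<open>-2\<close> times the integral over \<open>t \<in> [pi/3, pi/2]\<close>, \<open>x \<in> [0, 1]\<close> of the nonnegative kernel
  \<open>(ln (2 cos t))\<^sup>2 2 sin t / (1 + 2 x cos t + x\<^sup>2)\<close>. By Tonelli one may integrate over \<open>x\<close> first,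
  which only needs an arctangent, and what remains is the log-cosine integral
  \<open>\<integral> t (ln (2 cos t))\<^sup>2 dt\<close> over \<open>[pi/3, pi/2]\<close> (\<open>has_integral_mult_ln_two_cos_squared\<close>).

  That integral is a contour integral in disguise. The point \<open>z = 1 + cis (2 t) = 2 cos t cis t\<close> has
  \<open>Ln z = ln (2 cos t) + \<i> t\<close>, whose cube has imaginary part \<open>3 t (ln (2 cos t))\<^sup>2 - t\<^sup>3\<close>; and
  \<open>dz = 2 \<i> cis (2 t) dt = -2 \<i> (1 - z) dt\<close>. So it suffices to integrate \<open>(Ln z)\<^sup>3 / (1 - z)\<close> along an
  arc from \<open>cis (pi/3)\<close> to \<open>0\<close>, and this function has an explicit primitive built from
  \<open>Li\<^sub>2\<close>, \<open>Li\<^sub>3\<close>, \<open>Li\<^sub>4\<close> and \<open>Ln\<close> (\<open>Ln_cubed_primitive\<close>), continuous up to both ends of the arc.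

  The real part of the primitive at \<open>cis (pi/3)\<close> involves only \<open>Re Li\<^sub>2\<close>, \<open>Im Li\<^sub>3\<close> and \<open>Re Li\<^sub>4\<close>
  there. On the unit circle these are polynomials in the angle (\<open>Re_polylog_2_cis\<close>,
  \<open>Im_polylog_3_cis\<close>, \<open>Re_polylog_4_cis\<close>), so that everything is a rational multiple of \<open>pi ^ 4\<close>.
\<close>

section \<open>Polylogarithms on the unit disc\<close>

lemma norm_polylog_term_le:
  fixes z :: "'a::{real_normed_field, banach}"
  assumes "norm z \<le> 1" "k \<ge> 2"
  shows "norm (z ^ Suc n / of_nat (Suc n) ^ k) \<le> 1 / (real (Suc n))\<^sup>2"
proof -
  have "norm (z ^ Suc n / of_nat (Suc n) ^ k) = norm z ^ Suc n / real (Suc n) ^ k"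
    by (simp add: norm_divide norm_power norm_mult del: of_nat_Suc)
  also have "\<dots> \<le> 1 / (real (Suc n))\<^sup>2"
    using assms by (intro frac_le power_le_one power_increasing) auto
  finally show ?thesis .
qed

lemma summable_inverse_Suc_squared: "summable (\<lambda>n. 1 / (real (Suc n))\<^sup>2)"
  using sums_summable[OF inverse_squares_sums] by (simp add: add.commute)

lemma polylog_sums:
  fixes z :: "'a::{real_normed_field, banach}"
  assumes "norm z \<le> 1" "k \<ge> 2"
  shows "(\<lambda>n. z ^ Suc n / of_nat (Suc n) ^ k) sums polylog k z"
  unfolding polylog_def
  by (intro summable_sums summable_comparison_test'[OF summable_inverse_Suc_squared]
        norm_polylog_term_le assms)

lemma continuous_on_polylog:
  assumes "k \<ge> 2"
  shows "continuous_on (cball 0 1) (polylog k :: 'a::{real_normed_field, banach} \<Rightarrow> 'a)"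
proof (rule uniform_limit_theorem)
  show "uniform_limit (cball 0 1) (\<lambda>m z. \<Sum>n<m. z ^ Suc n / of_nat (Suc n) ^ k)
          (polylog k :: 'a \<Rightarrow> 'a) sequentially"
    unfolding polylog_def
    by (rule Weierstrass_m_test[OF norm_polylog_term_le summable_inverse_Suc_squared])
       (use assms in auto)
  show "\<forall>\<^sub>F m in sequentially. continuous_on (cball 0 1)
          (\<lambda>z::'a. \<Sum>n<m. z ^ Suc n / of_nat (Suc n) ^ k)"
    by (intro always_eventually allI continuous_intros) (auto simp del: of_nat_Suc)
qed simp

text \<open>
  The coefficient at exponent \<open>0\<close> has to be set to \<open>0\<close> by hand: for \<open>k = 0\<close> the formula
  \<open>1 / of_nat n ^ k\<close> would give \<open>1\<close> there. With it the term-wise differentiation theorem for power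
  series applies.
\<close>

lemma polylog_eq_power_series:
  fixes z :: "'a::{real_normed_field, banach}"
  assumes "norm z < 1"
  shows "summable (\<lambda>n. (if n = 0 then 0 else 1 / of_nat n ^ k) * z ^ n)"
    and "polylog k z = (\<Sum>n. (if n = 0 then 0 else 1 / of_nat n ^ k) * z ^ n)"
proof -
  let ?c = "\<lambda>n. if n = 0 then 0 else 1 / of_nat n ^ k :: 'a"
  show sm: "summable (\<lambda>n. ?c n * z ^ n)"
  proof (rule summable_comparison_test'[of "\<lambda>n. norm z ^ n" 0])
    show "summable (\<lambda>n. norm z ^ n)" using assms by (simp add: summable_geometric)
    show "norm (?c n * z ^ n) \<le> norm z ^ n" for n
      by (simp add: norm_mult norm_divide norm_power mult_le_cancel_right1 divide_le_eq_1 field_simps)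
  qed
  show "polylog k z = (\<Sum>n. ?c n * z ^ n)"
    using suminf_split_head[OF sm] by (simp add: polylog_def del: of_nat_Suc power_Suc)
qed

lemma polylog_0_left:
  fixes z :: "'a::{real_normed_field, banach}"
  assumes "norm z < 1"
  shows "polylog 0 z = z / (1 - z)"
  using suminf_mult[OF summable_geometric[OF assms], of z] suminf_geometric[OF assms]
  by (simp add: polylog_def)

lemma has_field_derivative_polylog:
  fixes z :: "'a::{real_normed_field, banach}"
  assumes "norm z < 1" "z \<noteq> 0"
  shows "(polylog (Suc k) has_field_derivative polylog k z / z) (at z)"
proof -
  let ?c = "\<lambda>k n. if n = 0 then 0 else 1 / of_nat n ^ k :: 'a"
  have "((\<lambda>z. \<Sum>n. ?c (Suc k) n * z ^ n) has_field_derivative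
          (\<Sum>n. diffs (?c (Suc k)) n * z ^ n)) (at z)"
    by (rule termdiffs_strong'[of 1]) (use assms polylog_eq_power_series(1) in auto)
  also have "(\<Sum>n. diffs (?c (Suc k)) n * z ^ n) = (\<Sum>n. z ^ Suc n / of_nat (Suc n) ^ k / z)"
    using assms(2) by (intro suminf_cong) (simp add: diffs_def del: of_nat_Suc)
  also have "\<dots> = polylog k z / z"
  proof -
    have "summable (\<lambda>n. z ^ Suc n / of_nat (Suc n) ^ k)"
      using polylog_eq_power_series(1)[OF assms(1), of k, THEN summable_Suc_iff[THEN iffD2]]
      by simp
    from suminf_divide[OF this, of z] show ?thesis by (simp add: polylog_def)
  qed
  finally show ?thesis
  proof (rule has_field_derivative_transform_within_open[where S = "ball 0 1"])
    show "(\<Sum>n. ?c (Suc k) n * y ^ n) = polylog (Suc k) y" if "y \<in> ball 0 1" for y :: 'a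
      using polylog_eq_power_series(2)[of y "Suc k"] that by simp
  qed (use assms in auto)
qed

text \<open>
  Vanishing to first order at \<open>0\<close> is what tames the logarithmic factors in the primitives below.
  The constant \<open>2\<close> is the sum of the geometric series with ratio \<open>1/2\<close>.
\<close>

lemma norm_polylog_le:
  fixes z :: "'a::{real_normed_field, banach}"
  assumes "norm z < 1/2"
  shows "norm (polylog k z) \<le> 2 * norm z"
proof -
  have geo: "(\<lambda>n. norm z * (1/2) ^ n) sums (norm z * 2)"
    using geometric_sums[of "1/2::real"] by (intro sums_mult) simp
  have le: "norm (z ^ Suc n / of_nat (Suc n) ^ k) \<le> norm z * (1/2) ^ n" for n
  proof -
    have "norm (z ^ Suc n / of_nat (Suc n) ^ k) = norm z * norm z ^ n / real (Suc n) ^ k"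
      by (simp add: norm_divide norm_power norm_mult del: of_nat_Suc)
    also have "\<dots> \<le> norm z * (1/2) ^ n / 1"
      using assms by (intro frac_le mult_left_mono power_mono) auto
    finally show ?thesis by simp
  qed
  have "norm (polylog k z) \<le> (\<Sum>n. norm z * (1/2) ^ n)"
    unfolding polylog_def using le geo by (intro norm_suminf_le) (auto simp: sums_iff)
  also have "\<dots> = 2 * norm z" using geo by (simp add: sums_iff)
  finally show ?thesis .
qed

lemma polylog_1_eq_Ln:
  assumes "norm z < 1"
  shows "polylog 1 z = - Ln (1 - z)"
proof -
  have "(\<lambda>n. z ^ n / of_nat n) sums (- Ln (1 - z))"
    using sums_minus[OF Ln_series'[of "-z"]] assms by simp
  hence "(\<lambda>n. z ^ Suc n / of_nat (Suc n)) sums (- Ln (1 - z))"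
    by (subst sums_Suc_iff) simp
  thus ?thesis by (simp add: polylog_def sums_iff)
qed

text \<open>
  Any power of a logarithm is beaten by a factor of size \<open>O(norm z)\<close>. The logarithm \<open>l\<close> is left
  abstract to cover both the real one and the complex one, whose imaginary part accounts for \<open>D\<close>.
\<close>

lemma continuous_log_power_mult_at_0:
  fixes l f :: "'a::real_normed_field \<Rightarrow> 'a"
  assumes l: "\<And>z. z \<in> S \<Longrightarrow> z \<noteq> 0 \<Longrightarrow> norm (l z) \<le> D + \<bar>ln (norm z)\<bar>"
    and f: "\<And>z. norm z < 1/2 \<Longrightarrow> norm (f z) \<le> 2 * norm z"
  shows "continuous (at 0 within S) (\<lambda>z. l z ^ j * f z)"
proof -
  let ?b = "\<lambda>r::real. (D + \<bar>ln r\<bar>) ^ j * (2 * r)"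
  have f0: "f 0 = 0" using f[of 0] by simp
  have "(?b \<longlongrightarrow> 0) (at_right 0)" by real_asymp
  moreover have "filterlim (norm :: 'a \<Rightarrow> real) (at_right 0) (at 0 within S)"
    unfolding filterlim_at by (auto intro!: tendsto_eq_intros simp: eventually_at_filter)
  ultimately have "((\<lambda>z. ?b (norm z)) \<longlongrightarrow> 0) (at 0 within S)"
    by (rule filterlim_compose)
  moreover have "norm (l z ^ j * f z) \<le> ?b (norm z)"
    if "z \<in> S" "z \<noteq> 0" "norm z < 1/2" for z
    unfolding norm_mult norm_power
    using l[OF that(1,2)] f[OF that(3)] norm_ge_zero[of "l z"]
    by (intro mult_mono power_mono zero_le_power) (linarith | simp)+
  hence "\<forall>\<^sub>F z in at 0 within S. norm (l z ^ j * f z) \<le> ?b (norm z)"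
    unfolding eventually_at by (intro exI[of _ "1/2"]) auto
  ultimately show ?thesis
    unfolding continuous_within f0 using Lim_null_comparison by fastforce
qed

section \<open>Boundary values: Bernoulli polynomials\<close>

lemma polylog_cis_sums:
  assumes "k \<ge> 2"
  shows "(\<lambda>n. cis (real (Suc n) * t) / of_nat (Suc n) ^ k) sums polylog k (cis t)"
  using polylog_sums[of "cis t" k] assms by (simp only: Complex.DeMoivre) simp

lemma Re_polylog_cis_sums:
  assumes "k \<ge> 2"
  shows "(\<lambda>n. cos (real (Suc n) * t) / real (Suc n) ^ k) sums Re (polylog k (cis t))"
proof -
  have "Re (cis (real (Suc n) * t) / of_nat (Suc n) ^ k) = cos (real (Suc n) * t) / real (Suc n) ^ k" for n
    using Re_divide_of_real[of "cis (real (Suc n) * t)" "real (Suc n) ^ k"]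
    by (simp only: of_real_of_nat_eq of_real_power cis.sel)
  with sums_Re[OF polylog_cis_sums[OF assms, of t]] show ?thesis by (simp only:)
qed

lemma Im_polylog_cis_sums:
  assumes "k \<ge> 2"
  shows "(\<lambda>n. sin (real (Suc n) * t) / real (Suc n) ^ k) sums Im (polylog k (cis t))"
proof -
  have "Im (cis (real (Suc n) * t) / of_nat (Suc n) ^ k) = sin (real (Suc n) * t) / real (Suc n) ^ k" for n
    using Im_divide_of_real[of "cis (real (Suc n) * t)" "real (Suc n) ^ k"]
    by (simp only: of_real_of_nat_eq of_real_power cis.sel)
  with sums_Im[OF polylog_cis_sums[OF assms, of t]] show ?thesis by (simp only:)
qed

text \<open>
  For \<open>k \<ge> 2\<close> the differentiated Fourier series still converges uniformly, so that differentiation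
  in the angle lowers the order by one. The step from order \<open>2\<close> to order \<open>1\<close> is not covered.
\<close>

lemma has_real_derivative_Im_polylog_cis:
  assumes "k \<ge> 2"
  shows "((\<lambda>t. Im (polylog (Suc k) (cis t))) has_real_derivative Re (polylog k (cis t))) (at t)"
proof -
  let ?f = "\<lambda>n t. sin (real (Suc n) * t) / real (Suc n) ^ Suc k"
  let ?g = "\<lambda>n t. cos (real (Suc n) * t) / real (Suc n) ^ k"
  have "((\<lambda>t. \<Sum>n. ?f n t) has_field_derivative (\<Sum>n. ?g n t)) (at t)"
  proof (rule has_field_derivative_series'(2)[where S = UNIV and ?x0.0 = 0])
    show "(?f n has_field_derivative ?g n x) (at x within UNIV)" for n x
      by (auto intro!: derivative_eq_intros simp del: of_nat_Suc)
    show "uniformly_convergent_on UNIV (\<lambda>n x. \<Sum>i<n. ?g i x)"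
    proof (rule Weierstrass_m_test'[OF _ summable_inverse_Suc_squared])
      show "norm (?g n x) \<le> 1 / (real (Suc n))\<^sup>2" for n x
        unfolding real_norm_def abs_divide power_abs abs_of_nat
        using assms by (intro frac_le abs_cos_le_one power_increasing) auto
    qed
  qed auto
  thus ?thesis
    using Im_polylog_cis_sums[of "Suc k"] Re_polylog_cis_sums[of k] assms
    by (simp add: sums_iff del: of_nat_Suc)
qed

lemma has_real_derivative_Re_polylog_cis:
  assumes "k \<ge> 2"
  shows "((\<lambda>t. Re (polylog (Suc k) (cis t))) has_real_derivative - Im (polylog k (cis t))) (at t)"
proof -
  let ?f = "\<lambda>n t. cos (real (Suc n) * t) / real (Suc n) ^ Suc k"
  let ?g = "\<lambda>n t. - (sin (real (Suc n) * t) / real (Suc n) ^ k)"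
  have "((\<lambda>t. \<Sum>n. ?f n t) has_field_derivative (\<Sum>n. ?g n t)) (at t)"
  proof (rule has_field_derivative_series'(2)[where S = UNIV and ?x0.0 = 0])
    show "(?f n has_field_derivative ?g n x) (at x within UNIV)" for n x
      by (auto intro!: derivative_eq_intros simp del: of_nat_Suc)
    show "uniformly_convergent_on UNIV (\<lambda>n x. \<Sum>i<n. ?g i x)"
    proof (rule Weierstrass_m_test'[OF _ summable_inverse_Suc_squared])
      show "norm (?g n x) \<le> 1 / (real (Suc n))\<^sup>2" for n x
        unfolding real_norm_def abs_minus_cancel abs_divide power_abs abs_of_nat
        using assms by (intro frac_le abs_sin_le_one power_increasing) auto
    qed
    show "summable (\<lambda>n. ?f n 0)"
      using Re_polylog_cis_sums[of "Suc k" 0] assms by (simp add: sums_iff del: of_nat_Suc)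
  qed auto
  thus ?thesis
    using Re_polylog_cis_sums[of "Suc k"] Im_polylog_cis_sums[of k] assms
    by (simp add: sums_iff suminf_minus del: of_nat_Suc)
qed

lemma has_vector_derivative_cis_mult:
  "((\<lambda>t. cis (c * t)) has_vector_derivative of_real c * \<i> * cis (c * t)) (at t)"
  unfolding has_vector_derivative_def
  by (auto intro!: derivative_eq_intros simp: fun_eq_iff scaleR_conv_of_real)

lemma Ln_one_minus_cis:
  assumes "0 < t" "t < 2 * pi"
  shows "Ln (1 - cis t) = Complex (ln (2 * sin (t / 2))) ((t - pi) / 2)"
proof -
  have "1 - cis t = rcis (2 * sin (t / 2)) ((t - pi) / 2)"
    using cos_double_sin[of "t/2"] sin_double[of "t/2"]
    by (simp add: complex_eq_iff rcis_def diff_divide_distrib cos_diff sin_diff power2_eq_square)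
  moreover have "sin (t / 2) > 0" using assms by (intro sin_gt_zero) auto
  ultimately show ?thesis using assms by (simp add: Ln_rcis)
qed

text \<open>
  The Fourier series of the derivative converges only conditionally here. Instead, \<open>- Ln (1 - z) / z\<close>
  is holomorphic on the upper half-plane and has a primitive \<open>M\<close> there; it differs from \<open>Li\<^sub>2\<close> by a
  constant inside the unit disc, hence by continuity also on the upper unit semicircle. As \<open>M\<close> is
  differentiable across that semicircle, the chain rule gives the derivative
  \<open>Re (- \<i> Ln (1 - cis t)) = Im (Ln (1 - cis t))\<close>.
\<close>

lemma has_real_derivative_Re_polylog_2_cis:
  assumes "0 < t" "t < pi"
  shows "((\<lambda>t. Re (polylog 2 (cis t))) has_real_derivative (t - pi) / 2) (at t)"
proof -
  let ?U = "{z. Im z > 0}"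
  let ?f = "\<lambda>z. - Ln (1 - z) / z"
  have U: "open ?U" "convex ?U" by (simp_all add: open_halfspace_Im_gt convex_halfspace_Im_gt)
  have "?f holomorphic_on ?U"
    by (intro holomorphic_intros) (auto simp: complex_nonpos_Reals_iff)
  then obtain M where M: "\<And>z. z \<in> ?U \<Longrightarrow> (M has_field_derivative ?f z) (at z within ?U)"
    using holomorphic_convex_primitive'[OF U(2,1)] by blast
  have M': "(M has_field_derivative ?f z) (at z)" if "z \<in> ?U" for z
    using M[OF that] at_within_open[OF that U(1)] by simp
  have "\<exists>c. \<forall>z\<in>?U \<inter> ball 0 1. M z - polylog 2 z = c"
  proof (rule has_field_derivative_zero_constant)
    show "convex (?U \<inter> ball 0 1)" using U by (intro convex_Int) auto
    fix z :: complex assume z: "z \<in> ?U \<inter> ball 0 1"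
    hence "z \<noteq> 0" by auto
    with z have "(polylog 2 has_field_derivative ?f z) (at z)"
      using has_field_derivative_polylog[of z 1] polylog_1_eq_Ln[of z]
      by (auto simp: numeral_2_eq_2)
    with M'[of z] z have "((\<lambda>z. M z - polylog 2 z) has_field_derivative ?f z - ?f z) (at z)"
      by (intro derivative_intros) auto
    thus "((\<lambda>z. M z - polylog 2 z) has_field_derivative 0) (at z within ?U \<inter> ball 0 1)"
      by (simp add: has_field_derivative_at_within)
  qed
  then obtain c where c: "\<And>z. z \<in> ?U \<Longrightarrow> norm z < 1 \<Longrightarrow> M z - polylog 2 z = c" by auto
  \<comment> \<open>Approach the boundary point along its radius.\<close>
  have bd: "polylog 2 (cis s) = M (cis s) - c" if s: "0 < s" "s < pi" for s
  proof -
    let ?z = "\<lambda>r. of_real r * cis s"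
    have zU: "?z r \<in> ?U" if "r > 0" for r using s that by (simp add: sin_gt_zero)
    have cont: "continuous_on {1/2..1} (\<lambda>r. M (?z r) - polylog 2 (?z r))"
    proof (rule continuous_on_diff)
      have z: "continuous_on {1/2..1} ?z" by (intro continuous_intros)
      have "continuous_on ?U M"
        using M' by (intro continuous_at_imp_continuous_on ballI) (rule DERIV_isCont)
      thus "continuous_on {1/2..1} (\<lambda>r. M (?z r))"
        by (rule continuous_on_compose2[OF _ z]) (use zU in force)
      show "continuous_on {1/2..1} (\<lambda>r. polylog 2 (?z r))"
        by (rule continuous_on_compose2[OF continuous_on_polylog z]) (auto simp: norm_mult)
    qed
    have cl: "closure {1/2..<1} = {1/2..(1::real)}" by simp
    have "M (?z 1) - polylog 2 (?z 1) = c"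
      by (rule continuous_constant_on_closure[of "{1/2..<1}" "\<lambda>r. M (?z r) - polylog 2 (?z r)"])
         (use cont cl c zU in \<open>auto simp: norm_mult\<close>)
    thus ?thesis by (simp add: algebra_simps)
  qed
  have "cis t \<in> ?U" using assms by (simp add: sin_gt_zero)
  from field_vector_diff_chain_at[OF has_vector_derivative_cis_mult[of 1, simplified] M'[OF this]]
  have "((\<lambda>s. M (cis s) - c) has_vector_derivative (\<i> * cis t * ?f (cis t)) - 0) (at t)"
    unfolding o_def by (intro has_vector_derivative_diff has_vector_derivative_const)
  from bounded_linear.has_vector_derivative[OF bounded_linear_Re this]
  have "((\<lambda>s. Re (M (cis s) - c)) has_vector_derivative Re (\<i> * cis t * ?f (cis t))) (at t)"
    by simp
  moreover have "\<i> * cis t * ?f (cis t) = - \<i> * Ln (1 - cis t)"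
    by (simp add: field_simps)
  ultimately have "((\<lambda>s. Re (M (cis s) - c)) has_real_derivative (t - pi) / 2) (at t)"
    using assms Ln_one_minus_cis[of t] by (simp add: has_real_derivative_iff_has_vector_derivative)
  thus ?thesis
    by (rule has_field_derivative_transform_within_open[where S = "{0<..<pi}"]) (use assms bd in auto)
qed

lemma eq_plus_const_if_same_derivative:
  fixes f p :: "real \<Rightarrow> real"
  assumes "a < b" "continuous_on {a..b} f" "continuous_on {a..b} p"
    and "\<And>x. a < x \<Longrightarrow> x < b \<Longrightarrow> (f has_real_derivative g x) (at x)"
    and "\<And>x. a < x \<Longrightarrow> x < b \<Longrightarrow> (p has_real_derivative g x) (at x)"
    and "a \<le> x" "x \<le> b"
  shows "f x = f a - p a + p x"
proof -
  have "f x - p x = f a - p a"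
  proof (rule DERIV_isconst2[of a b])
    show "((\<lambda>x. f x - p x) has_real_derivative 0) (at x)" if "a < x" "x < b" for x
      using DERIV_diff[OF assms(4,5)[OF that]] by simp
  qed (use assms in \<open>auto intro!: continuous_intros\<close>)
  thus ?thesis by simp
qed

lemma continuous_on_polylog_cis:
  "k \<ge> 2 \<Longrightarrow> continuous_on S (\<lambda>t. polylog k (cis t))"
  by (intro continuous_on_compose2[OF continuous_on_polylog] continuous_intros) auto

lemma Re_polylog_2_cis:
  assumes "0 \<le> t" "t \<le> pi"
  shows "Re (polylog 2 (cis t)) = pi\<^sup>2 / 6 - pi * t / 2 + t\<^sup>2 / 4"
proof -
  have "(\<lambda>n. 1 / (real (Suc n))\<^sup>2) sums (pi\<^sup>2 / 6)"
    using inverse_squares_sums by (simp add: add.commute)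
  with Re_polylog_cis_sums[of 2 0] have "Re (polylog 2 (cis 0)) = pi\<^sup>2 / 6"
    by (simp add: sums_iff del: cis_zero)
  moreover have "Re (polylog 2 (cis t)) = Re (polylog 2 (cis 0)) - (0\<^sup>2 / 4 - pi * 0 / 2) + (t\<^sup>2 / 4 - pi * t / 2)"
    by (rule eq_plus_const_if_same_derivative[where b = pi and g = "\<lambda>t. (t - pi) / 2"])
       (use assms has_real_derivative_Re_polylog_2_cis in \<open>auto intro!: continuous_intros continuous_on_polylog_cis
          derivative_eq_intros simp: field_simps\<close>)
  ultimately show ?thesis by simp
qed

lemma Im_polylog_3_cis:
  assumes "0 \<le> t" "t \<le> pi"
  shows "Im (polylog 3 (cis t)) = pi\<^sup>2 * t / 6 - pi * t\<^sup>2 / 4 + t ^ 3 / 12"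
proof -
  let ?p = "\<lambda>t. pi\<^sup>2 * t / 6 - pi * t\<^sup>2 / 4 + t ^ 3 / 12"
  have "Im (polylog 3 (cis 0)) = 0"
    using Im_polylog_cis_sums[of 3 0] by (simp add: sums_iff del: cis_zero)
  moreover have "Im (polylog 3 (cis t)) = Im (polylog 3 (cis 0)) - ?p 0 + ?p t"
  proof (rule eq_plus_const_if_same_derivative[where b = pi and g = "\<lambda>t. pi\<^sup>2 / 6 - pi * t / 2 + t\<^sup>2 / 4"])
    show "((\<lambda>t. Im (polylog 3 (cis t))) has_real_derivative pi\<^sup>2 / 6 - pi * x / 2 + x\<^sup>2 / 4) (at x)"
      if "0 < x" "x < pi" for x
      using has_real_derivative_Im_polylog_cis[of 2 x] Re_polylog_2_cis[of x] that
      by (simp add: numeral_3_eq_3 numeral_2_eq_2)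
  qed (use assms in \<open>auto intro!: continuous_intros continuous_on_polylog_cis
          derivative_eq_intros simp: field_simps\<close>)
  ultimately show ?thesis by simp
qed

text \<open>
  Integrating \<open>- Im Li\<^sub>3\<close> determines \<open>Re Li\<^sub>4\<close> up to its value at angle \<open>0\<close>, which is
  \<open>\<zeta>(4)\<close>. This constant is found by integrating once more: \<open>Im Li\<^sub>5\<close> is a sine series and vanishes at
  both \<open>0\<close> and \<open>pi\<close>.
\<close>

lemma Re_polylog_4_cis:
  assumes "0 \<le> t" "t \<le> pi"
  shows "Re (polylog 4 (cis t)) = pi ^ 4 / 90 - pi\<^sup>2 * t\<^sup>2 / 12 + pi * t ^ 3 / 12 - t ^ 4 / 48"
proof -
  let ?p = "\<lambda>t. - pi\<^sup>2 * t\<^sup>2 / 12 + pi * t ^ 3 / 12 - t ^ 4 / 48"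
  let ?C = "Re (polylog 4 (cis 0))"
  have *: "Re (polylog 4 (cis s)) = ?C + ?p s" if "0 \<le> s" "s \<le> pi" for s
  proof -
    have "Re (polylog 4 (cis s)) = ?C - ?p 0 + ?p s"
    proof (rule eq_plus_const_if_same_derivative[where b = pi
             and g = "\<lambda>t. - (pi\<^sup>2 * t / 6 - pi * t\<^sup>2 / 4 + t ^ 3 / 12)"])
      show "((\<lambda>t. Re (polylog 4 (cis t))) has_real_derivative
               - (pi\<^sup>2 * x / 6 - pi * x\<^sup>2 / 4 + x ^ 3 / 12)) (at x)" if "0 < x" "x < pi" for x
        using has_real_derivative_Re_polylog_cis[of 3 x] Im_polylog_3_cis[of x] that by simp
    qed (use that in \<open>auto intro!: continuous_intros continuous_on_polylog_cis
            derivative_eq_intros simp: field_simps\<close>)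
    thus ?thesis by simp
  qed
  let ?q = "\<lambda>t. ?C * t - pi\<^sup>2 * t ^ 3 / 36 + pi * t ^ 4 / 48 - t ^ 5 / 240"
  have "Im (polylog 5 (cis 0)) = 0"
    using Im_polylog_cis_sums[of 5 0] by (simp add: sums_iff del: cis_zero)
  moreover have "Im (polylog 5 (cis pi)) = 0"
  proof -
    have "sin (real (Suc n) * pi) = 0" for n by (rule sin_npi)
    with Im_polylog_cis_sums[of 5 pi] show ?thesis
      by (simp add: sums_iff del: cis_pi of_nat_Suc)
  qed
  moreover have "Im (polylog 5 (cis pi)) = Im (polylog 5 (cis 0)) - ?q 0 + ?q pi"
  proof (rule eq_plus_const_if_same_derivative[where b = pi and g = "\<lambda>t. ?C + ?p t"])
    show "((\<lambda>t. Im (polylog 5 (cis t))) has_real_derivative ?C + ?p x) (at x)"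
      if "0 < x" "x < pi" for x
      using has_real_derivative_Im_polylog_cis[of 4 x] *[of x] that by simp
  qed (auto intro!: continuous_intros continuous_on_polylog_cis derivative_eq_intros simp: field_simps)
  ultimately have "?q pi = 0" by simp
  hence "pi * ?C = pi * (pi ^ 4 / 90)"
    by (simp add: field_simps eval_nat_numeral)
  hence "?C = pi ^ 4 / 90" by simp
  with *[OF assms] show ?thesis by simp
qed

section \<open>The log-cosine integral\<close>

text \<open>
  A primitive of \<open>- (Ln z)\<^sup>3 / (1 - z)\<close>, found by repeated integration by parts: each step
  differentiates a power of \<open>Ln z\<close> and integrates \<open>Li\<^sub>k(z) / z\<close> to \<open>Li\<^sub>k\<^sub>+\<^sub>1(z)\<close>. The last summand uses
  \<open>Ln (1 - z)\<close> in place of \<open>- Li\<^sub>1(z)\<close>, whose series does not converge absolutely on the unit circle.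
\<close>

definition Ln_cubed_primitive :: "complex \<Rightarrow> complex" where
  "Ln_cubed_primitive z =
     6 * polylog 4 z - 6 * (Ln z * polylog 3 z) + 3 * (Ln z ^ 2 * polylog 2 z) + Ln z ^ 3 * Ln (1 - z)"

lemma has_field_derivative_Ln_cubed_primitive:
  assumes "norm z < 1" "Re z > 0"
  shows "(Ln_cubed_primitive has_field_derivative - (Ln z ^ 3 / (1 - z))) (at z)"
proof -
  have z: "z \<noteq> 0" "z \<notin> \<real>\<^sub>\<le>\<^sub>0" using assms by (auto simp: complex_nonpos_Reals_iff)
  have "1 - z \<notin> \<real>\<^sub>\<le>\<^sub>0" "1 - z \<noteq> 0"
    using assms complex_Re_le_cmod[of z] by (auto simp: complex_nonpos_Reals_iff)
  note d = has_field_derivative_polylog[OF assms(1) z(1)]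
  have d4: "(polylog 4 has_field_derivative polylog 3 z / z) (at z)" using d[of 3] by simp
  have d3: "(polylog 3 has_field_derivative polylog 2 z / z) (at z)"
    using d[of 2] by (simp add: numeral_3_eq_3 numeral_2_eq_2)
  have d2: "(polylog 2 has_field_derivative - Ln (1 - z) / z) (at z)"
    using d[of 1] polylog_1_eq_Ln[OF assms(1)] by (simp add: numeral_2_eq_2)
  show ?thesis
    unfolding Ln_cubed_primitive_def
    by (rule derivative_eq_intros d4 d3 d2 refl z \<open>1 - z \<notin> \<real>\<^sub>\<le>\<^sub>0\<close>)+
       (use z \<open>1 - z \<noteq> 0\<close> in \<open>simp add: field_simps power2_eq_square power3_eq_cube\<close>)
qed

lemma norm_Ln_le_pi_plus:
  assumes "z \<noteq> 0"
  shows "norm (Ln z) \<le> pi + \<bar>ln (norm z)\<bar>"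
proof -
  have "\<bar>Im (Ln z)\<bar> \<le> pi" using Im_Ln_le_pi[OF assms] mpi_less_Im_Ln[OF assms] by simp
  thus ?thesis using cmod_le[of "Ln z"] Re_Ln[OF assms] by simp
qed

text \<open>
  The region contains the whole arc \<open>1 + cis (2 * t)\<close> for \<open>t\<close> in \<open>[pi/3, pi/2]\<close>. The arc starts on the
  unit circle and ends at \<open>0\<close>, where the default value \<open>Ln 0 = 0\<close> agrees with the limit \<open>0\<close> of
  each summand.
\<close>

lemma continuous_on_Ln_cubed_primitive:
  "continuous_on {z. norm z \<le> 1 \<and> (z = 0 \<or> Re z > 0) \<and> z \<noteq> 1} Ln_cubed_primitive"
  (is "continuous_on ?T _")
  unfolding continuous_on_eq_continuous_within
proof
  fix z assume z: "z \<in> ?T"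
  have Li: "continuous (at z within ?T) (polylog k)" if "k \<ge> 2" for k
    using continuous_on_polylog[OF that, where 'a = complex] z
    by (intro continuous_within_subset[of _ "cball 0 1" _ ?T])
       (auto simp: continuous_on_eq_continuous_within)
  have summands: "continuous (at z within ?T) (\<lambda>z. Ln z ^ j * f z)"
    if f: "continuous (at z within ?T) f"
      and small: "\<And>z. norm z < 1/2 \<Longrightarrow> norm (f z) \<le> 2 * norm z" for j f
  proof (cases "z = 0")
    case True
    show ?thesis
      unfolding True by (rule continuous_log_power_mult_at_0[OF norm_Ln_le_pi_plus small])
  next
    case False
    with z have "z \<notin> \<real>\<^sub>\<le>\<^sub>0" by (auto simp: complex_nonpos_Reals_iff)
    thus ?thesis by (intro continuous_intros f)
  qed
  have "1 - z \<notin> \<real>\<^sub>\<le>\<^sub>0"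
  proof
    assume "1 - z \<in> \<real>\<^sub>\<le>\<^sub>0"
    hence "Re z \<ge> 1" "Im z = 0" by (auto simp: complex_nonpos_Reals_iff)
    with z complex_Re_le_cmod[of z] show False by (auto simp: complex_eq_iff)
  qed
  hence "continuous (at z within ?T) (\<lambda>z. Ln (1 - z))"
    by (rule continuous_at_imp_continuous_within[OF isCont_Ln'[rotated]]) simp
  moreover have "norm (Ln (1 - z)) \<le> 2 * norm z" if "norm z < 1/2" for z
    using norm_Ln_le[of "- z"] that by simp
  ultimately have "continuous (at z within ?T) (\<lambda>z. Ln z ^ 3 * Ln (1 - z))"
    by (rule summands)
  moreover have "continuous (at z within ?T) (\<lambda>z. Ln z ^ j * polylog k z)" if "k \<ge> 2" for j k
    using Li[OF that] norm_polylog_le by (rule summands)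
  from this[of 3 1] this[of 2 2]
  have "continuous (at z within ?T) (\<lambda>z. Ln z * polylog 3 z)"
    "continuous (at z within ?T) (\<lambda>z. Ln z ^ 2 * polylog 2 z)" by simp_all
  ultimately show "continuous (at z within ?T) Ln_cubed_primitive"
    unfolding Ln_cubed_primitive_def using Li[of 4]
    by (intro continuous_add continuous_diff continuous_mult_left) simp_all
qed

lemma one_plus_cis_double: "1 + cis (2 * t) = rcis (2 * cos t) t"
  by (simp add: complex_eq_iff cos_double_cos sin_double power2_eq_square)

lemma Ln_one_plus_cis_double:
  assumes "\<bar>t\<bar> < pi / 2"
  shows "Ln (1 + cis (2 * t)) = Complex (ln (2 * cos t)) t"
  unfolding one_plus_cis_double
  using assms cos_gt_zero_pi[of t] by (intro Ln_rcis) auto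

lemma two_cos_bounds:
  assumes "pi / 3 < t" "t < pi / 2"
  shows "0 < 2 * cos t" "2 * cos t < 1"
  using assms cos_gt_zero_pi[of t] cos_monotone_0_pi[of "pi/3" t] by (auto simp: cos_60)

text \<open>
  Along \<open>z = 1 + cis (2 t)\<close> one has \<open>1 - z = - cis (2 t)\<close>, which cancels against \<open>dz/dt\<close>; the
  fundamental theorem is applied on the open arc and the primitive is continuous at its ends.
\<close>

lemma has_integral_Ln_cubed_arc:
  "((\<lambda>t. Complex (ln (2 * cos t)) t ^ 3) has_integral \<i> / 2 * Ln_cubed_primitive (cis (pi / 3)))
     {pi / 3..pi / 2}"
proof -
  let ?w = "\<lambda>t. 1 + cis (2 * t)"
  let ?g = "\<lambda>t. Ln_cubed_primitive (?w t)"
  have "((\<lambda>t. 2 * \<i> * Complex (ln (2 * cos t)) t ^ 3) has_integral ?g (pi / 2) - ?g (pi / 3))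
          {pi / 3..pi / 2}"
  proof (rule fundamental_theorem_of_calculus_interior)
    show "continuous_on {pi / 3..pi / 2} ?g"
    proof (rule continuous_on_compose2[OF continuous_on_Ln_cubed_primitive])
      show "continuous_on {pi / 3..pi / 2} ?w" by (intro continuous_intros)
      show "?w ` {pi / 3..pi / 2} \<subseteq> {z. norm z \<le> 1 \<and> (z = 0 \<or> Re z > 0) \<and> z \<noteq> 1}"
      proof safe
        fix t :: real assume t: "t \<in> {pi / 3..pi / 2}"
        have "0 \<le> cos t" "cos t \<le> 1/2"
          using t cos_ge_zero[of t] cos_monotone_0_pi_le[of "pi/3" t] by (auto simp: cos_60)
        thus "norm (?w t) \<le> 1" by (simp add: one_plus_cis_double)
        show "?w t = 0" if "\<not> Re (?w t) > 0"
          using that \<open>0 \<le> cos t\<close> by (cases "cos t = 0") (auto simp: one_plus_cis_double)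
        show False if "?w t = 1" using that by simp
      qed
    qed
    fix t assume t: "t \<in> {pi / 3<..<pi / 2}"
    note b = two_cos_bounds[of t]
    have n: "norm (?w t) < 1" "Re (?w t) > 0" using t b by (simp_all add: one_plus_cis_double)
    have "(?w has_vector_derivative 0 + of_real 2 * \<i> * cis (2 * t)) (at t)"
      by (intro has_vector_derivative_add has_vector_derivative_const has_vector_derivative_cis_mult)
    from field_vector_diff_chain_at[OF this has_field_derivative_Ln_cubed_primitive[OF n]]
    show "(?g has_vector_derivative 2 * \<i> * Complex (ln (2 * cos t)) t ^ 3) (at t)"
      using Ln_one_plus_cis_double[of t] t by (simp add: o_def mult.assoc)
  qed simp
  moreover have "?g (pi / 2) = 0" by (simp add: Ln_cubed_primitive_def polylog_def)
  moreover have "?w (pi / 3) = cis (pi / 3)"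
    by (simp add: complex_eq_iff cos_60 sin_60 cos_120 sin_120)
  ultimately have "((\<lambda>t. 2 * \<i> * Complex (ln (2 * cos t)) t ^ 3) has_integral
                     - Ln_cubed_primitive (cis (pi / 3))) {pi / 3..pi / 2}" by simp
  from has_integral_mult_right[OF this, of "- \<i> / 2"] show ?thesis
    by (simp add: field_simps)
qed

lemma Re_Ln_cubed_primitive_cis_pi_3:
  "Re (Ln_cubed_primitive (cis (pi / 3))) = 221 * pi ^ 4 / 3240"
proof -
  have "1 - cis (pi / 3) = cis (- (pi / 3))"
    by (simp add: complex_eq_iff cos_60)
  moreover have "Ln (cis (pi / 3)) = \<i> * (pi / 3)" "Ln (cis (- (pi / 3))) = \<i> * (- (pi / 3))"
    using pi_ge_two by (subst Ln_cis; simp)+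
  ultimately have L: "Ln (cis (pi / 3)) = \<i> * (pi / 3)" "Ln (1 - cis (pi / 3)) = \<i> * (- (pi / 3))"
    by simp_all
  have "Re (polylog 2 (cis (pi / 3))) = pi\<^sup>2 / 36"
    using Re_polylog_2_cis[of "pi / 3"] by (simp add: field_simps eval_nat_numeral)
  moreover have "Im (polylog 3 (cis (pi / 3))) = 5 * pi ^ 3 / 162"
    using Im_polylog_3_cis[of "pi / 3"] by (simp add: field_simps eval_nat_numeral)
  moreover have "Re (polylog 4 (cis (pi / 3))) = 91 * pi ^ 4 / 19440"
    using Re_polylog_4_cis[of "pi / 3"] by (simp add: field_simps eval_nat_numeral)
  moreover have "Re (6 * p4 - 6 * (\<i> * (pi / 3) * p3) + 3 * ((\<i> * (pi / 3)) ^ 2 * p2)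
        + (\<i> * (pi / 3)) ^ 3 * (\<i> * (- (pi / 3))))
      = 6 * Re p4 + 2 * pi * Im p3 - pi\<^sup>2 / 3 * Re p2 - pi ^ 4 / 81" for p2 p3 p4
    by (simp add: power2_eq_square power3_eq_cube power4_eq_xxxx field_simps)
  ultimately have "Re (Ln_cubed_primitive (cis (pi / 3)))
      = 6 * (91 * pi ^ 4 / 19440) + 2 * pi * (5 * pi ^ 3 / 162) - pi\<^sup>2 / 3 * (pi\<^sup>2 / 36) - pi ^ 4 / 81"
    unfolding Ln_cubed_primitive_def L by (simp only:)
  thus ?thesis by (simp add: power2_eq_square power3_eq_cube power4_eq_xxxx)
qed

text \<open>
  The imaginary part of \<open>(L + \<i> t)\<^sup>3\<close> is \<open>3 t L\<^sup>2 - t\<^sup>3\<close>.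
\<close>

lemma has_integral_mult_ln_two_cos_squared:
  "((\<lambda>t. t * (ln (2 * cos t))\<^sup>2) has_integral 403 * pi ^ 4 / 25920) {pi / 3..pi / 2}"
proof -
  have "((\<lambda>t. Im (Complex (ln (2 * cos t)) t ^ 3)) has_integral 221 * pi ^ 4 / 6480)
          {pi / 3..pi / 2}"
    using has_integral_linear[OF has_integral_Ln_cubed_arc bounded_linear_Im]
    by (simp add: o_def Re_Ln_cubed_primitive_cis_pi_3)
  moreover have "((\<lambda>t. t ^ 3) has_integral (pi / 2) ^ 4 / 4 - (pi / 3) ^ 4 / 4) {pi / 3..pi / 2}"
    by (rule fundamental_theorem_of_calculus)
       (auto intro!: derivative_eq_intros simp flip: has_real_derivative_iff_has_vector_derivative)
  ultimately have "((\<lambda>t. (Im (Complex (ln (2 * cos t)) t ^ 3) + t ^ 3) / 3) has_integral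
      (221 * pi ^ 4 / 6480 + ((pi / 2) ^ 4 / 4 - (pi / 3) ^ 4 / 4)) / 3) {pi / 3..pi / 2}"
    by (intro has_integral_divide has_integral_add)
  moreover have "(Im (Complex L t ^ 3) + t ^ 3) / 3 = t * L\<^sup>2" for L t
    by (simp add: power3_eq_cube power2_eq_square algebra_simps)
  ultimately show ?thesis by (simp add: field_simps)
qed

section \<open>Reduction to the log-cosine integral\<close>

text \<open>
  A primitive of \<open>(ln a)\<^sup>2 u / (1 + a u)\<close> in \<open>a\<close>, obtained by integration by parts as for
  \<open>Ln_cubed_primitive\<close>. It vanishes at \<open>a = 0\<close>, and at \<open>a = 1\<close> only the term with \<open>Li\<^sub>3\<close> survives.
\<close>

definition ln_squared_primitive :: "real \<Rightarrow> real \<Rightarrow> real" where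
  "ln_squared_primitive u a =
     2 * (ln a * polylog 2 (- (a * u))) - (ln a ^ 2 * polylog 1 (- (a * u))) - 2 * polylog 3 (- (a * u))"

lemma has_real_derivative_ln_squared_primitive:
  assumes "0 < a" "0 < u" "a * u < 1"
  shows "(ln_squared_primitive u has_real_derivative (ln a)\<^sup>2 * u / (1 + a * u)) (at a)"
proof -
  have n: "norm (- (a * u)) < 1" "- (a * u) \<noteq> 0" using assms by auto
  have d: "((\<lambda>a. polylog (Suc k) (- (a * u))) has_real_derivative polylog k (- (a * u)) / a) (at a)" for k
  proof -
    have "((\<lambda>a. - (a * u)) has_real_derivative - u) (at a)" by (auto intro!: derivative_eq_intros)
    from DERIV_chain2[where g = "\<lambda>a. - (a * u)", OF has_field_derivative_polylog[OF n] this]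
    show ?thesis using assms by (simp add: field_simps)
  qed
  have d3: "((\<lambda>a. polylog 3 (- (a * u))) has_real_derivative polylog 2 (- (a * u)) / a) (at a)"
    using d[of 2] by (simp add: numeral_3_eq_3 numeral_2_eq_2)
  have d2: "((\<lambda>a. polylog 2 (- (a * u))) has_real_derivative polylog 1 (- (a * u)) / a) (at a)"
    using d[of 1] by (simp add: numeral_2_eq_2)
  define q where "q = u / (1 + a * u)"
  have d1: "((\<lambda>a. polylog 1 (- (a * u))) has_real_derivative - q) (at a)"
    using d[of 0] polylog_0_left[OF n(1)] assms by (simp add: q_def)
  have "(ln_squared_primitive u has_real_derivative (ln a)\<^sup>2 * q) (at a)"
    unfolding ln_squared_primitive_def
    by (rule derivative_eq_intros d3 d2 d1 refl assms)+
       (use assms in \<open>simp add: field_simps power2_eq_square\<close>)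
  thus ?thesis by (simp add: q_def)
qed

lemma continuous_on_ln_squared_primitive:
  assumes "0 < u" "u < 1"
  shows "continuous_on {0..1} (ln_squared_primitive u)"
  unfolding continuous_on_eq_continuous_within
proof
  fix a :: real assume a: "a \<in> {0..1}"
  show "continuous (at a within {0..1}) (ln_squared_primitive u)"
  proof (cases "a = 0")
    case False
    moreover have "a * u < 1" using a assms by (smt (verit) mult_left_le_one_le atLeastAtMost_iff)
    ultimately have "isCont (ln_squared_primitive u) a"
      using a assms by (intro DERIV_isCont[OF has_real_derivative_ln_squared_primitive]) auto
    thus ?thesis by (rule continuous_at_imp_continuous_within)
  next
    case True
    have "norm (polylog k (- (a * u))) \<le> 2 * norm a" if "norm a < 1/2" for a k
    proof -
      have "norm (- (a * u)) \<le> norm a"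
        using assms by (simp add: abs_mult mult_left_le)
      thus ?thesis using norm_polylog_le[of "- (a * u)" k] that by linarith
    qed
    hence *: "continuous (at 0 within {0..1}) (\<lambda>a. ln a ^ j * polylog k (- (a * u)))" for j k
      by (intro continuous_log_power_mult_at_0[where D = 0]) auto
    show ?thesis
      unfolding True ln_squared_primitive_def[abs_def]
      using *[of 1 2] *[of 2 1] *[of 0 3]
      by (intro continuous_diff continuous_mult_left) simp_all
  qed
qed

text \<open>
  The integrand \<open>(ln a)\<^sup>2 / (1 + a x + x\<^sup>2)\<close> after the substitution \<open>a = 2 cos t\<close>; the factor
  \<open>2 sin t\<close> is the Jacobian.
\<close>

definition log_cos_kernel :: "real \<Rightarrow> real \<Rightarrow> real" where
  "log_cos_kernel t x = (ln (2 * cos t))\<^sup>2 * (2 * sin t / (1 + 2 * x * cos t + x\<^sup>2))"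

text \<open>
  Multiplied by \<open>x\<close>, the kernel is \<open>(ln a)\<^sup>2 u / (1 + a u)\<close> with \<open>u = x / (1 + x\<^sup>2)\<close>, so its primitive
  is known.
\<close>

lemma has_integral_log_cos_kernel_angle:
  assumes "0 < x"
  shows "((\<lambda>t. log_cos_kernel t x) has_integral - (2 * polylog 3 (- (x / (1 + x\<^sup>2))) / x)) {pi / 3..pi / 2}"
proof -
  define u where "u = x / (1 + x\<^sup>2)"
  have "0 < u" using assms by (simp add: u_def add_pos_nonneg)
  have "(x - 1)\<^sup>2 + x > 0" using assms by (intro add_nonneg_pos) auto
  hence "u < 1" by (simp add: u_def power2_eq_square algebra_simps add_pos_nonneg)
  let ?P = "ln_squared_primitive u"
  have "((\<lambda>t. x * log_cos_kernel t x) has_integral - ?P (2 * cos (pi / 2)) - - ?P (2 * cos (pi / 3))) {pi / 3..pi / 2}"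
  proof (rule fundamental_theorem_of_calculus_interior)
    show "continuous_on {pi / 3..pi / 2} (\<lambda>t. - ?P (2 * cos t))"
    proof (intro continuous_on_minus continuous_on_compose2[OF continuous_on_ln_squared_primitive])
      show "(\<lambda>t. 2 * cos t) ` {pi / 3..pi / 2} \<subseteq> {0..1}"
      proof safe
        fix t :: real assume t: "t \<in> {pi / 3..pi / 2}"
        show "2 * cos t \<in> {0..1}"
          using t cos_ge_zero[of t] cos_monotone_0_pi_le[of "pi/3" t] by (auto simp: cos_60)
      qed
    qed (use \<open>0 < u\<close> \<open>u < 1\<close> in \<open>auto intro!: continuous_intros\<close>)
    fix t assume "t \<in> {pi / 3<..<pi / 2}"
    hence b: "0 < 2 * cos t" "2 * cos t < 1" using two_cos_bounds by auto
    have "2 * cos t * u < 1 * 1"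
      using b \<open>0 < u\<close> \<open>u < 1\<close> by (intro mult_strict_mono) auto
    hence "((\<lambda>t. - ?P (2 * cos t)) has_real_derivative
        - ((ln (2 * cos t))\<^sup>2 * u / (1 + 2 * cos t * u) * (2 * - sin t))) (at t)"
      using b \<open>0 < u\<close>
      by (intro DERIV_minus DERIV_chain2[OF has_real_derivative_ln_squared_primitive] DERIV_cmult DERIV_cos) auto
    also have "- ((ln (2 * cos t))\<^sup>2 * u / (1 + 2 * cos t * u) * (2 * - sin t)) = x * log_cos_kernel t x"
    proof -
      have "u / (1 + 2 * cos t * u) = x / (1 + 2 * x * cos t + x\<^sup>2)"
      proof -
        have p: "1 + x\<^sup>2 > 0" by (simp add: add_pos_nonneg)
        have "1 + 2 * cos t * u = (1 + 2 * x * cos t + x\<^sup>2) / (1 + x\<^sup>2)"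
          using p by (simp add: u_def field_simps)
        thus ?thesis using p by (simp add: u_def)
      qed
      moreover have "- (L * u / D * (2 * - s)) = L * (2 * s) * (u / D)" for L D s :: real
        by simp
      ultimately show ?thesis by (simp only: log_cos_kernel_def) simp
    qed
    finally show "((\<lambda>t. - ?P (2 * cos t)) has_vector_derivative x * log_cos_kernel t x) (at t)"
      by (simp add: has_real_derivative_iff_has_vector_derivative)
  qed simp
  moreover have "?P (2 * cos (pi / 2)) = 0" "?P (2 * cos (pi / 3)) = - 2 * polylog 3 (- u)"
    by (simp_all add: ln_squared_primitive_def cos_60 polylog_def)
  ultimately have "((\<lambda>t. x * log_cos_kernel t x) has_integral - 2 * polylog 3 (- u)) {pi / 3..pi / 2}"
    by simp
  from has_integral_divide[OF this, of x] show ?thesis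
    using assms by (simp add: u_def)
qed

text \<open>
  Since \<open>1 + 2 x cos t + x\<^sup>2 = (x + cos t)\<^sup>2 + (sin t)\<^sup>2\<close>, the primitive is an arctangent. Its values at
  both ends are angles because \<open>(1 + cos t) / sin t\<close> and \<open>cos t / sin t\<close> are the cotangents of
  \<open>t / 2\<close> and \<open>t\<close>.
\<close>

lemma has_integral_log_cos_kernel_abscissa:
  assumes "0 < t" "t < pi"
  shows "(log_cos_kernel t has_integral t * (ln (2 * cos t))\<^sup>2) {0..1}"
proof -
  let ?A = "\<lambda>x. 2 * arctan ((x + cos t) / sin t)"
  have s: "sin t > 0" using assms by (intro sin_gt_zero)
  have "((\<lambda>x. 2 * sin t / (1 + 2 * x * cos t + x\<^sup>2)) has_integral ?A 1 - ?A 0) {0..1}"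
  proof (rule fundamental_theorem_of_calculus)
    fix x :: real
    have sq: "1 + ((x + cos t) / sin t)\<^sup>2 = (1 + 2 * x * cos t + x\<^sup>2) / (sin t)\<^sup>2"
      using s sin_cos_squared_add[of t] by (simp add: field_simps power2_eq_square)
    have "(?A has_real_derivative 2 * (inverse (1 + ((x + cos t) / sin t)\<^sup>2) * (1 / sin t))) (at x within {0..1})"
      by (intro DERIV_cmult DERIV_chain2[OF DERIV_arctan] DERIV_cdivide) (auto intro!: derivative_eq_intros)
    also have "2 * (inverse (1 + ((x + cos t) / sin t)\<^sup>2) * (1 / sin t)) = 2 * sin t / (1 + 2 * x * cos t + x\<^sup>2)"
      unfolding sq using s by (simp add: power2_eq_square)
    finally show "(?A has_vector_derivative 2 * sin t / (1 + 2 * x * cos t + x\<^sup>2)) (at x within {0..1})"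
      by (simp add: has_real_derivative_iff_has_vector_derivative)
  qed simp
  also have "?A 1 = pi - t"
  proof -
    have "(1 + cos t) / sin t = tan (pi / 2 - t / 2)"
    proof -
      have c: "cos (t / 2) > 0" "sin (t / 2) > 0"
        using assms by (auto intro!: cos_gt_zero_pi sin_gt_zero)
      have "(1 + cos t) / sin t = (2 * (cos (t / 2))\<^sup>2) / (2 * sin (t / 2) * cos (t / 2))"
        using cos_double_cos[of "t/2"] sin_double[of "t/2"] by simp
      thus ?thesis using c by (simp add: tan_def cos_diff sin_diff power2_eq_square)
    qed
    moreover have "arctan (tan (pi / 2 - t / 2)) = pi / 2 - t / 2"
      using assms by (intro arctan_tan) auto
    ultimately show ?thesis by simp
  qed
  also have "?A 0 = pi - 2 * t"
  proof -
    have "cos t / sin t = tan (pi / 2 - t)" by (simp add: tan_def cos_diff sin_diff)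
    moreover have "arctan (tan (pi / 2 - t)) = pi / 2 - t"
      using assms by (intro arctan_tan) auto
    ultimately show ?thesis by simp
  qed
  finally have "((\<lambda>x. 2 * sin t / (1 + 2 * x * cos t + x\<^sup>2)) has_integral t) {0..1}" by simp
  from has_integral_mult_right[OF this, of "(ln (2 * cos t))\<^sup>2"] show ?thesis
    by (simp add: log_cos_kernel_def[abs_def] mult.commute)
qed

lemma log_cos_kernel_nonneg:
  assumes "t \<in> {pi / 3..pi / 2}" "0 \<le> x"
  shows "log_cos_kernel t x \<ge> 0"
proof -
  have "sin t \<ge> 0" "cos t \<ge> 0"
    using assms by (auto intro!: sin_ge_zero cos_ge_zero)
  thus ?thesis using assms by (simp add: log_cos_kernel_def)
qed

theorem theorem5p0p3:
  "((\<lambda>x::real. 4 * polylog 3 (- (x / (1 + x ^ 2))) / x) has_integral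
     - (403 * pi ^ 4 / 12960)) {0..1}"
proof -
  let ?T = "{pi / 3..pi / 2}" and ?X = "{0<..<1::real}"
  \<comment> \<open>The integrand scaled by \<open>- 1/2\<close>, which makes it nonnegative. The point \<open>x = 0\<close>, where
    division by zero falsifies the kernel identity, is avoided by integrating over the open interval.\<close>
  define g :: "real \<Rightarrow> real" where "g x = - (2 * polylog 3 (- (x / (1 + x\<^sup>2))) / x)" for x
  let ?I = "403 * pi ^ 4 / 25920"
  have angle: "(\<integral>\<^sup>+t. ennreal (log_cos_kernel t x) * indicator ?T t \<partial>lborel) = ennreal (g x)" if "0 < x" for x
    using has_integral_log_cos_kernel_angle[OF that] that unfolding g_def
    by (intro nn_integral_has_integral_lebesgue') (auto intro!: log_cos_kernel_nonneg)
  have abscissa: "(\<integral>\<^sup>+x. ennreal (log_cos_kernel t x) * indicator ?X x \<partial>lborel) = ennreal (t * (ln (2 * cos t))\<^sup>2)"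
    if "t \<in> ?T" for t
    using has_integral_log_cos_kernel_abscissa[of t] that pi_ge_two
    by (intro nn_integral_has_integral_lebesgue')
       (auto intro!: log_cos_kernel_nonneg simp flip: has_integral_Icc_iff_Ioo)
  have "(\<integral>\<^sup>+x. ennreal (g x) * indicator ?X x \<partial>lborel)
      = (\<integral>\<^sup>+x. \<integral>\<^sup>+t. ennreal (log_cos_kernel t x) * indicator ?T t * indicator ?X x \<partial>lborel \<partial>lborel)"
    by (intro nn_integral_cong) (auto simp: angle nn_integral_multc split: split_indicator)
  also have "\<dots> = (\<integral>\<^sup>+t. \<integral>\<^sup>+x. ennreal (log_cos_kernel t x) * indicator ?T t * indicator ?X x \<partial>lborel \<partial>lborel)"
    by (rule lborel_pair.Fubini') (unfold log_cos_kernel_def, measurable)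
  also have "\<dots> = (\<integral>\<^sup>+t. ennreal (t * (ln (2 * cos t))\<^sup>2) * indicator ?T t \<partial>lborel)"
    by (intro nn_integral_cong) (auto simp: abscissa split: split_indicator)
  also have "\<dots> = ennreal ?I"
    by (intro nn_integral_has_integral_lebesgue' has_integral_mult_ln_two_cos_squared)
       (use pi_gt_zero in \<open>auto intro!: mult_nonneg_nonneg\<close>)
  finally have total: "(\<integral>\<^sup>+x. ennreal (g x) * indicator ?X x \<partial>lborel) = ennreal ?I" .
  have "((\<lambda>x. if x \<in> ?X then g x else 0) has_integral ?I) UNIV"
  proof (rule nn_integral_has_integral)
    have "continuous_on ?X g"
      unfolding g_def
    proof (intro continuous_intros continuous_on_compose2[OF continuous_on_polylog])
      have p: "1 + x\<^sup>2 > 0" for x :: real by (simp add: add_pos_nonneg)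
      thus "\<forall>x\<in>?X. 1 + x\<^sup>2 \<noteq> 0" by (metis less_irrefl)
      have "x / (1 + x\<^sup>2) \<le> 1" if "x < 1" for x :: real
      proof -
        have "x \<le> 1 + x\<^sup>2" using that zero_le_power2[of x] by linarith
        thus ?thesis using p[of x] by simp
      qed
      thus "(\<lambda>x. - (x / (1 + x\<^sup>2))) ` ?X \<subseteq> cball 0 1" by auto
    qed auto
    thus "(\<lambda>x. if x \<in> ?X then g x else 0) \<in> borel_measurable borel"
      by (intro borel_measurable_continuous_on_if) auto
    show "(if x \<in> ?X then g x else 0) \<ge> 0" for x
      using has_integral_nonneg[OF has_integral_log_cos_kernel_angle[of x]] log_cos_kernel_nonneg[of _ x] by (auto simp: g_def)
    show "(\<integral>\<^sup>+x. ennreal (if x \<in> ?X then g x else 0) \<partial>lborel) = ennreal ?I"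
      unfolding total[symmetric] by (intro nn_integral_cong) (auto split: split_indicator)
  qed simp
  hence "(g has_integral ?I) {0..1}"
    by (simp only: has_integral_restrict_UNIV has_integral_Icc_iff_Ioo)
  from has_integral_mult_right[OF this, of "- 2"] show ?thesis
    by (simp add: g_def)
qed

end
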